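(* Let $(X,\Sigma_X)$ and $(Y,\Sigma_Y)$ be measurable spaces, $\mu$ a probability measure on $X$, $\mathcal{V}:X\times\Sigma_Y\to[0,1]$ a Markov kernel, and $\mathcal{M}(dq,dv)=\mathcal{V}(q,dv)\,\mu(dq)$ the associated probability measure on $X\times Y$. Let $p\ge 1$ and let $S_j:X\times Y\to X\times Y$, $j=0,1,\dots,p$, be measurable mappings with $S_j\circ S_j=I$ for every $j$. Assume that for every $j=0,1,\dots,p$, $$\sum_{k=0}^p (S_j\circ S_k)^*\mathcal{M}(E)=\sum_{k=0}^p S_k^*\mathcal{M}(E)\quad\text{for all measurable } E\subseteq X\times Y.$$ Let $\alpha_j:X\times Y\to[0,1]$, $j=0,\dots,p$, be any measurable functions such that $\sum_{j=0}^p\int_Y\alpha_j(q,v)\,\mathcal{V}(q,dv)=1$ for every $q\in X$, and $$\alpha_j(q,v)=\frac{dS_j^*\mathcal{M}}{d(S_0^*\mathcal{M}+\cdots+S_p^*\mathcal{M})}(q,v)\quad\text{for } \Big(\sum_{k=0}^p S_k^*\mathcal{M}\Big)\text{-a.e. }(q,v)\in X\times Y.$$ Then for every $j=0,\dots,p$, $$\alpha_j(S_j(q,v))\,S_j^*\mathcal{M}(dq,dv)=\alpha_j(q,v)\,\mathcal{M}(dq,dv),$$ and consequently also $\sum_{j=0}^p\int_Y \alpha_j(S_j(q,v))\,S_j^*\mathcal{M}(dq,dv)=\mu(dq)$. Therefore the Markov kernel $$P^{\alpha,S,\mathcal{V}}(q,d\tilde q)=\sum_{j=0}^p\int_Y\alpha_j(q,v)\,\delta_{\Pi_1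 S_j(q,v)}(d\tilde q)\,\mathcal{V}(q,dv)$$ satisfies detailed balance with respect to $\mu$, i.e. $P^{\alpha,S,\mathcal{V}}(q,d\tilde q)\,\mu(dq)=P^{\alpha,S,\mathcal{V}}(\tilde q,dq)\,\mu(d\tilde q)$, and thus $\mu P^{\alpha,S,\mathcal{V}}=\mu$.
   Context: A Markov kernel $\mathcal{V}:X\times\Sigma_Y\to[0,1]$ is a map such that $\mathcal{V}(q,\cdot)$ is a probability measure on $Y$ for each $q$ and $q\mapsto\mathcal{V}(q,E)$ is measurable for each $E\in\Sigma_Y$. $\Pi_1(q,v)=q$. $\phi^*\nu$ denotes the pushforward of the measure $\nu$ by $\phi$: $\phi^*\nu(E)=\nu(\phi^{-1}(E))$. $d\nu/d\rho$ denotes the Radon–Nikodym derivative. $\mu P(d\tilde q)=\int_X P(q,d\tilde q)\,\mu(dq)$. *)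

theory Defs
  imports "HOL-Probability.Probability"
begin

text \<open>
  A measurable space is represented by a value of type \<open>'a measure\<close> of which only the
  underlying \<open>space\<close> and \<open>sets\<close> are used.  A Markov kernel from \<open>X\<close> to \<open>Y\<close> is an element of
  \<open>X \<rightarrow>\<^sub>M prob_algebra Y\<close>, and the pushforward of \<open>\<nu>\<close> by \<open>\<phi>\<close> is \<open>distr \<nu> Z \<phi>\<close>.
\<close>

definition sum_measure :: "'a measure \<Rightarrow> 'i set \<Rightarrow> ('i \<Rightarrow> 'a measure) \<Rightarrow> 'a measure" where
  "sum_measure Z I N = measure_of (space Z) (sets Z) (\<lambda>E. \<Sum>i\<in>I. emeasure (N i) E)"

text \<open>The measure \<open>K(q,dv) \<mu>(dq)\<close> on the product of \<open>X\<close> and \<open>Y\<close>.\<close>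

definition kernel_joint ::
    "'a measure \<Rightarrow> 'b measure \<Rightarrow> 'a measure \<Rightarrow> ('a \<Rightarrow> 'b measure) \<Rightarrow> ('a \<times> 'b) measure" where
  "kernel_joint X Y \<mu> K = bind \<mu> (\<lambda>q. distr (K q) (X \<Otimes>\<^sub>M Y) (Pair q))"

text \<open>
  The kernel \<open>P(q,dq') = \<Sum>\<^sub>j \<integral> \<alpha>\<^sub>j(q,v) \<delta>\<^bsub>\<Pi>\<^sub>1 S\<^sub>j(q,v)\<^esub>(dq') V(q,dv)\<close>, where \<open>return X x\<close> is the
  Dirac measure at \<open>x\<close>.
\<close>

definition involutive_kernel ::
    "'a measure \<Rightarrow> nat \<Rightarrow> (nat \<Rightarrow> 'a \<times> 'b \<Rightarrow> real) \<Rightarrow> (nat \<Rightarrow> 'a \<times> 'b \<Rightarrow> 'a \<times> 'b)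
      \<Rightarrow> ('a \<Rightarrow> 'b measure) \<Rightarrow> 'a \<Rightarrow> 'a measure" where
  "involutive_kernel X p \<alpha> S V q =
     measure_of (space X) (sets X)
       (\<lambda>E. \<Sum>j\<le>p. \<integral>\<^sup>+ v. ennreal (\<alpha> j (q, v)) * emeasure (return X (fst (S j (q, v)))) E \<partial>(V q))"

text \<open>
  As measures in \<open>(q, q')\<close>: \<open>P(q,dq') \<mu>(dq) = P(q',dq) \<mu>(dq')\<close>.  The right-hand side is the
  image of the left-hand side under the exchange of the coordinates.
\<close>

definition detailed_balance :: "'a measure \<Rightarrow> 'a measure \<Rightarrow> ('a \<Rightarrow> 'a measure) \<Rightarrow> bool" where
  "detailed_balance X \<mu> P \<longleftrightarrow>
     kernel_joint X X \<mu> P = distr (kernel_joint X X \<mu> P) (X \<Otimes>\<^sub>M X) prod.swap"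


lemma space_sum_measure [simp]: "space (sum_measure Z I N) = space Z"
  by (simp add: sum_measure_def)

lemma sets_sum_measure [simp, measurable_cong]: "sets (sum_measure Z I N) = sets Z"
  by (simp add: sum_measure_def)

lemma emeasure_sum_measure:
  assumes sets: "\<And>i. i \<in> I \<Longrightarrow> sets (N i) = sets Z" and E: "E \<in> sets Z"
  shows "emeasure (sum_measure Z I N) E = (\<Sum>i\<in>I. emeasure (N i) E)"
proof (rule emeasure_measure_of[OF sum_measure_def])
  show "countably_additive (sets (sum_measure Z I N)) (\<lambda>E. \<Sum>i\<in>I. emeasure (N i) E)"
  proof (rule countably_additiveI)
    fix A :: "nat \<Rightarrow> _" assume A: "range A \<subseteq> sets (sum_measure Z I N)" "disjoint_family A"
    have "(\<Sum>n. \<Sum>i\<in>I. emeasure (N i) (A n)) = (\<Sum>i\<in>I. \<Sum>n. emeasure (N i) (A n))"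
      by (rule suminf_sum) simp
    also have "\<dots> = (\<Sum>i\<in>I. emeasure (N i) (\<Union>n. A n))"
      using A sets by (intro sum.cong refl suminf_emeasure) auto
    finally show "(\<Sum>n. \<Sum>i\<in>I. emeasure (N i) (A n)) = (\<Sum>i\<in>I. emeasure (N i) (\<Union>n. A n))" .
  qed
qed (use E sets.space_closed in \<open>auto simp: positive_def\<close>)

lemma kernel_joint_kernel:
  assumes "sets \<mu> = sets X" "K \<in> X \<rightarrow>\<^sub>M prob_algebra Y"
  shows "(\<lambda>q. distr (K q) (X \<Otimes>\<^sub>M Y) (Pair q)) \<in> \<mu> \<rightarrow>\<^sub>M prob_algebra (X \<Otimes>\<^sub>M Y)"
proof -
  have [measurable_cong]: "sets \<mu> = sets X" and [measurable]: "K \<in> X \<rightarrow>\<^sub>M prob_algebra Y"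
    by fact+
  show ?thesis by (rule measurable_distr_prob_space2[where M = Y]) measurable
qed

lemma emeasure_kernel_joint:
  assumes mu: "prob_space \<mu>" "sets \<mu> = sets X"
    and K: "K \<in> X \<rightarrow>\<^sub>M prob_algebra Y" and E: "E \<in> sets (X \<Otimes>\<^sub>M Y)"
  shows "emeasure (kernel_joint X Y \<mu> K) E = (\<integral>\<^sup>+ q. \<integral>\<^sup>+ v. indicator E (q, v) \<partial>(K q) \<partial>\<mu>)"
proof -
  have "emeasure (kernel_joint X Y \<mu> K) E
      = (\<integral>\<^sup>+ q. emeasure (distr (K q) (X \<Otimes>\<^sub>M Y) (Pair q)) E \<partial>\<mu>)"
    unfolding kernel_joint_def
    using mu E measurable_prob_algebraD[OF kernel_joint_kernel[OF mu(2) K]]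
    by (intro emeasure_bind prob_space.not_empty)
  also have "\<dots> = (\<integral>\<^sup>+ q. \<integral>\<^sup>+ v. indicator E (q, v) \<partial>(K q) \<partial>\<mu>)"
  proof (rule nn_integral_cong)
    fix q assume "q \<in> space \<mu>"
    then have q: "q \<in> space X" using mu(2) sets_eq_imp_space_eq by blast
    then have [measurable_cong]: "sets (K q) = sets Y"
      using measurable_space[OF K] by (auto simp: space_prob_algebra)
    have [measurable]: "Pair q \<in> K q \<rightarrow>\<^sub>M X \<Otimes>\<^sub>M Y" using q by measurable
    show "emeasure (distr (K q) (X \<Otimes>\<^sub>M Y) (Pair q)) E = (\<integral>\<^sup>+ v. indicator E (q, v) \<partial>(K q))"
    proof -
      have "emeasure (distr (K q) (X \<Otimes>\<^sub>M Y) (Pair q)) E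
          = (\<integral>\<^sup>+ z. indicator E z \<partial>(distr (K q) (X \<Otimes>\<^sub>M Y) (Pair q)))"
        using E by simp
      also have "\<dots> = (\<integral>\<^sup>+ v. indicator E (q, v) \<partial>(K q))"
        using E by (intro nn_integral_distr) auto
      finally show ?thesis .
    qed
  qed
  finally show ?thesis .
qed

end

theory Submission
  imports Defs
begin

text \<open>
  Put \<open>R = \<Sum>\<^sub>k S\<^sub>k\<^sup>*M\<close>.  By assumption \<open>R\<close> is invariant under each involution \<open>S\<^sub>j\<close>, and
  \<open>S\<^sub>j\<^sup>*M = \<alpha>\<^sub>j R\<close>.  Pushing this identity forward by \<open>S\<^sub>j\<close> gives \<open>M = (\<alpha>\<^sub>j \<circ> S\<^sub>j) R\<close>, so that
  \<open>(\<alpha>\<^sub>j \<circ> S\<^sub>j) S\<^sub>j\<^sup>*M\<close> and \<open>\<alpha>\<^sub>j M\<close> both have density \<open>\<alpha>\<^sub>j \<cdot> (\<alpha>\<^sub>j \<circ> S\<^sub>j)\<close> with respect to \<open>R\<close>.  Since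
  \<open>(\<alpha>\<^sub>j \<circ> S\<^sub>j) S\<^sub>j\<^sup>*M\<close> is the pushforward of \<open>\<alpha>\<^sub>j M\<close> by \<open>S\<^sub>j\<close>, the measure \<open>\<alpha>\<^sub>j M\<close> is
  \<open>S\<^sub>j\<close>-invariant.  The joint law \<open>P(q,dq') \<mu>(dq)\<close> is the sum of the images of the \<open>\<alpha>\<^sub>j M\<close> under
  \<open>z \<mapsto> (\<Pi>\<^sub>1 z, \<Pi>\<^sub>1 (S\<^sub>j z))\<close>, and \<open>S\<^sub>j\<close> exchanges these two coordinates.
\<close>

section \<open>Densities and pushforwards under an involution\<close>

text \<open>Writing \<open>f z\<close> as \<open>f (S (S z))\<close> turns the integrand into a
  function of \<open>S z\<close> alone, so the change of variables formula applies and leaves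
  \<open>f\<close> composed with \<open>S\<close> as the density of the image measure.\<close>

lemma distr_density_involution:
  assumes sets: "sets M = sets Z"
    and S: "S \<in> Z \<rightarrow>\<^sub>M Z" "\<And>z. z \<in> space Z \<Longrightarrow> S (S z) = z"
    and f: "f \<in> borel_measurable Z"
  shows "distr (density M f) Z S = density (distr M Z S) (\<lambda>z. f (S z))"
proof (rule measure_eqI)
  note [measurable_cong] = sets and [measurable] = S(1) f
  have sp: "space M = space Z" using sets by (rule sets_eq_imp_space_eq)
  fix E assume "E \<in> sets (distr (density M f) Z S)"
  then have E [measurable]: "E \<in> sets Z" by simp
  have "emeasure (distr (density M f) Z S) E = (\<integral>\<^sup>+ z. f z * indicator (S -` E \<inter> space Z) z \<partial>M)"
    by (subst emeasure_distr) (simp_all add: emeasure_density sp)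
  also have "\<dots> = (\<integral>\<^sup>+ z. f (S (S z)) * indicator E (S z) \<partial>M)"
    using S sp by (intro nn_integral_cong) (auto split: split_indicator)
  also have "\<dots> = emeasure (density (distr M Z S) (\<lambda>z. f (S z))) E"
    by (simp add: emeasure_density nn_integral_distr)
  finally show "emeasure (distr (density M f) Z S) E
      = emeasure (density (distr M Z S) (\<lambda>z. f (S z))) E" .
qed simp

lemma distr_involution_twice:
  assumes sets: "sets M = sets Z"
    and S: "S \<in> Z \<rightarrow>\<^sub>M Z" "\<And>z. z \<in> space Z \<Longrightarrow> S (S z) = z"
  shows "distr (distr M Z S) Z S = M"
proof -
  note [measurable_cong] = sets and [measurable] = S(1)
  have "distr (distr M Z S) Z S = distr M Z (\<lambda>z. S (S z))"
    by (simp add: distr_distr comp_def)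
  \<comment> \<open>\<open>S\<close> is an involution on \<open>space Z\<close> only, but
    \<open>distr\<close> depends on the map only through its values on the space of the source, and
    on the target only through its space and sets.\<close>
  also have "\<dots> = distr M M (\<lambda>z. z)"
    using S(2) sets sets_eq_imp_space_eq[OF sets] by (intro distr_cong) auto
  finally show ?thesis by simp
qed

text \<open>Applied with \<open>S j\<close> for \<open>S\<close>, the sum of the pushforwards of
  \<open>M\<close> by all the \<open>S k\<close> for \<open>R\<close>, and \<open>\<alpha> j\<close>
  for \<open>g\<close>. Iterated densities multiply, so the symmetry comes down to commuting the
  factors \<open>g z\<close> and \<open>g (S z)\<close> over \<open>R\<close>.\<close>

lemma density_involution_symmetric:
  assumes sets: "sets M = sets Z"
    and S: "S \<in> Z \<rightarrow>\<^sub>M Z" "\<And>z. z \<in> space Z \<Longrightarrow> S (S z) = z"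
    and R: "sets R = sets Z" "distr R Z S = R"
    and g: "g \<in> borel_measurable Z" "density R g = distr M Z S"
  shows "density (distr M Z S) (\<lambda>z. g (S z)) = density M g"
proof -
  note [measurable_cong] = sets R(1) and [measurable] = S(1) g(1)
  have "M = distr (density R g) Z S"
    using distr_involution_twice[OF sets S] g(2) by simp
  also have "\<dots> = density R (\<lambda>z. g (S z))"
    using distr_density_involution[OF R(1) S g(1)] R(2) by simp
  finally have "density M g = density (density R (\<lambda>z. g (S z))) g" by (rule arg_cong)
  also have "\<dots> = density (density R g) (\<lambda>z. g (S z))"
    by (simp add: density_density_eq mult.commute)
  finally show ?thesis using g(2) by simp
qed

section \<open>Integration against the joint law of a measure and a kernel\<close>

lemma nn_integral_kernel_joint:
  assumes mu: "prob_space \<mu>" "sets \<mu> = sets X"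
    and K: "K \<in> X \<rightarrow>\<^sub>M prob_algebra Y" and f: "f \<in> borel_measurable (X \<Otimes>\<^sub>M Y)"
  shows "(\<integral>\<^sup>+ z. f z \<partial>(kernel_joint X Y \<mu> K)) = (\<integral>\<^sup>+ q. \<integral>\<^sup>+ v. f (q, v) \<partial>(K q) \<partial>\<mu>)"
proof -
  have "(\<integral>\<^sup>+ z. f z \<partial>(kernel_joint X Y \<mu> K))
      = (\<integral>\<^sup>+ q. \<integral>\<^sup>+ z. f z \<partial>(distr (K q) (X \<Otimes>\<^sub>M Y) (Pair q)) \<partial>\<mu>)"
    unfolding kernel_joint_def
    by (rule nn_integral_bind[OF f measurable_prob_algebraD[OF kernel_joint_kernel[OF mu(2) K]]])
  also have "\<dots> = (\<integral>\<^sup>+ q. \<integral>\<^sup>+ v. f (q, v) \<partial>(K q) \<partial>\<mu>)"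
  proof (rule nn_integral_cong)
    fix q assume "q \<in> space \<mu>"
    then have q: "q \<in> space X" using mu(2) sets_eq_imp_space_eq by blast
    then have [measurable_cong]: "sets (K q) = sets Y"
      using measurable_space[OF K] by (auto simp: space_prob_algebra)
    show "(\<integral>\<^sup>+ z. f z \<partial>(distr (K q) (X \<Otimes>\<^sub>M Y) (Pair q))) = (\<integral>\<^sup>+ v. f (q, v) \<partial>(K q))"
      using q f by (intro nn_integral_distr) auto
  qed
  finally show ?thesis .
qed

lemma sets_kernel_joint:
  assumes "prob_space \<mu>" "sets \<mu> = sets X" "K \<in> X \<rightarrow>\<^sub>M prob_algebra Y"
  shows "sets (kernel_joint X Y \<mu> K) = sets (X \<Otimes>\<^sub>M Y)"
  unfolding kernel_joint_def
  using measurable_prob_algebraD[OF kernel_joint_kernel[OF assms(2,3)]] assms(1)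
  by (intro sets_bind sets_kernel prob_space.not_empty)

lemma prob_space_kernel_joint:
  assumes "prob_space \<mu>" "sets \<mu> = sets X" "K \<in> X \<rightarrow>\<^sub>M prob_algebra Y"
  shows "prob_space (kernel_joint X Y \<mu> K)"
  unfolding kernel_joint_def
  by (rule prob_space_bind'[OF _ kernel_joint_kernel[OF assms(2,3)]])
    (simp add: space_prob_algebra assms(1))

lemma nn_integral_kernel_measurable:
  assumes K: "K \<in> X \<rightarrow>\<^sub>M prob_algebra Y" and f: "f \<in> borel_measurable (X \<Otimes>\<^sub>M Y)"
  shows "(\<lambda>q. \<integral>\<^sup>+ v. f (q, v) \<partial>(K q)) \<in> borel_measurable X"
  using f by (intro nn_integral_measurable_subprob_algebra2[OF _ measurable_prob_algebraD[OF K]]) simp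

text \<open>Each \<open>K q\<close> has total mass one, so integrating out the second coordinate
  leaves \<mu>. This is applied to the involutive kernel, with \<open>X\<close> in the place of
  \<open>Y\<close>.\<close>

lemma emeasure_kernel_joint_times_space:
  assumes mu: "prob_space \<mu>" "sets \<mu> = sets X" and K: "K \<in> X \<rightarrow>\<^sub>M prob_algebra Y"
    and E: "E \<in> sets X"
  shows "emeasure (kernel_joint X Y \<mu> K) (E \<times> space Y) = emeasure \<mu> E"
proof -
  have *: "(\<integral>\<^sup>+ v. indicator (E \<times> space Y) (q, v) \<partial>(K q)) = indicator E q" if "q \<in> space \<mu>" for q
  proof -
    have "q \<in> space X" using that mu(2) sets_eq_imp_space_eq by blast
    then have Kq: "prob_space (K q)" "sets (K q) = sets Y"
      using measurable_space[OF K] by (auto simp: space_prob_algebra)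
    have sp: "space (K q) = space Y" using Kq(2) by (rule sets_eq_imp_space_eq)
    have "(\<integral>\<^sup>+ v. indicator (E \<times> space Y) (q, v) \<partial>(K q)) = (\<integral>\<^sup>+ v. indicator E q \<partial>(K q))"
      by (rule nn_integral_cong) (simp add: indicator_times sp)
    then show ?thesis using prob_space.emeasure_space_1[OF Kq(1)] by simp
  qed
  have "emeasure (kernel_joint X Y \<mu> K) (E \<times> space Y)
      = (\<integral>\<^sup>+ q. \<integral>\<^sup>+ v. indicator (E \<times> space Y) (q, v) \<partial>(K q) \<partial>\<mu>)"
    using E by (intro emeasure_kernel_joint[OF mu K]) simp
  also have "\<dots> = (\<integral>\<^sup>+ q. indicator E q \<partial>\<mu>)" by (rule nn_integral_cong) (rule *)
  finally show ?thesis using E mu(2) by simp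
qed

section \<open>The involutive kernel and its joint law with \<mu>\<close>

context
  fixes X :: "'a measure" and Y :: "'b measure" and V :: "'a \<Rightarrow> 'b measure"
    and p :: nat and S :: "nat \<Rightarrow> 'a \<times> 'b \<Rightarrow> 'a \<times> 'b" and \<alpha> :: "nat \<Rightarrow> 'a \<times> 'b \<Rightarrow> real"
  assumes V: "V \<in> X \<rightarrow>\<^sub>M prob_algebra Y"
    and S [measurable]: "\<And>j. j \<le> p \<Longrightarrow> S j \<in> X \<Otimes>\<^sub>M Y \<rightarrow>\<^sub>M X \<Otimes>\<^sub>M Y"
    and \<alpha> [measurable]: "\<And>j. j \<le> p \<Longrightarrow> \<alpha> j \<in> borel_measurable (X \<Otimes>\<^sub>M Y)"
begin

lemma sets_involutive_kernel: "sets (involutive_kernel X p \<alpha> S V q) = sets X"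
  by (simp add: involutive_kernel_def)

text \<open>\<open>measure_of\<close> returns the prescribed set function only if that function is a
  measure. Here it is one because its j-th term is the image of the measure
  \<open>\<alpha>\<^sub>j(q,v) V(q,dv)\<close> under the map sending v to the first coordinate of
  \<open>S j (q, v)\<close>, and finite sums of measures are measures.\<close>

lemma emeasure_involutive_kernel:
  assumes q: "q \<in> space X" and E: "E \<in> sets X"
  shows "emeasure (involutive_kernel X p \<alpha> S V q) E
    = (\<Sum>j\<le>p. \<integral>\<^sup>+ v. ennreal (\<alpha> j (q, v)) * indicator E (fst (S j (q, v))) \<partial>(V q))"
proof -
  have Vq [measurable_cong]: "sets (V q) = sets Y"
    using measurable_space[OF V q] by (simp add: space_prob_algebra)
  let ?D = "\<lambda>j. distr (density (V q) (\<lambda>v. ennreal (\<alpha> j (q, v)))) X (\<lambda>v. fst (S j (q, v)))"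
  have Pair [measurable]: "Pair q \<in> V q \<rightarrow>\<^sub>M X \<Otimes>\<^sub>M Y" using q by simp
  have D: "emeasure (?D j) A = (\<integral>\<^sup>+ v. ennreal (\<alpha> j (q, v)) * indicator A (fst (S j (q, v))) \<partial>(V q))"
    if j: "j \<le> p" and A [measurable]: "A \<in> sets X" for j A
  proof -
    have [measurable]: "(\<lambda>v. S j (q, v)) \<in> V q \<rightarrow>\<^sub>M X \<Otimes>\<^sub>M Y" "(\<lambda>v. \<alpha> j (q, v)) \<in> borel_measurable (V q)"
      using measurable_compose[OF Pair S[OF j]] measurable_compose[OF Pair \<alpha>[OF j]] by auto
    show ?thesis
      by (auto simp: emeasure_distr emeasure_density intro!: nn_integral_cong split: split_indicator)
  qed
  have "involutive_kernel X p \<alpha> S V q = sum_measure X {..p} ?D"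
    unfolding involutive_kernel_def sum_measure_def
  \<comment> \<open>The two set functions need to agree on measurable sets only, and there the Dirac
    measure is an indicator.\<close>
  proof (rule measure_of_eq[OF sets.space_closed])
    fix A assume "A \<in> sigma_sets (space X) (sets X)"
    then have "A \<in> sets X" by (simp add: sets.sigma_sets_eq)
    then show "(\<Sum>j\<le>p. \<integral>\<^sup>+ v. ennreal (\<alpha> j (q, v)) * emeasure (return X (fst (S j (q, v)))) A \<partial>(V q))
        = (\<Sum>j\<le>p. emeasure (?D j) A)"
      by (intro sum.cong) (auto simp: D)
  qed
  then show ?thesis using E by (simp add: emeasure_sum_measure D)
qed

text \<open>Evaluated at \<open>space X\<close>, the indicator in each term is 1 because
  \<open>S j\<close> maps the product space into itself, so the total mass is the sum in the
  hypothesis. Measurability in q is checked for the mass of each set separately, where it follows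
  from that of \<open>V\<close>.\<close>

lemma involutive_kernel_kernel:
  assumes sum: "\<And>q. q \<in> space X \<Longrightarrow> (\<Sum>j\<le>p. \<integral>\<^sup>+ v. ennreal (\<alpha> j (q, v)) \<partial>(V q)) = 1"
  shows "involutive_kernel X p \<alpha> S V \<in> X \<rightarrow>\<^sub>M prob_algebra X"
proof -
  have prob: "prob_space (involutive_kernel X p \<alpha> S V q)" if q: "q \<in> space X" for q
  proof -
    have sp: "space (V q) = space Y"
      using measurable_space[OF V q] by (auto simp: space_prob_algebra dest: sets_eq_imp_space_eq)
    have ind: "indicator (space X) (fst (S j (q, v))) = (1::ennreal)" if "j \<le> p" "v \<in> space (V q)" for j v
      using measurable_space[OF S[OF that(1)], of "(q, v)"] that(2) q sp
      by (auto simp: space_pair_measure)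
    have "emeasure (involutive_kernel X p \<alpha> S V q) (space X)
        = (\<Sum>j\<le>p. \<integral>\<^sup>+ v. ennreal (\<alpha> j (q, v)) \<partial>(V q))"
      by (subst emeasure_involutive_kernel[OF q])
        (auto intro!: sum.cong nn_integral_cong simp: ind)
    then show ?thesis
      using sum[OF q] sets_eq_imp_space_eq[OF sets_involutive_kernel] by (intro prob_spaceI) simp
  qed
  show ?thesis
  proof (rule measurable_prob_algebraI[OF prob measurable_subprob_algebra])
    fix E assume E [measurable]: "E \<in> sets X"
    have "(\<lambda>q. \<Sum>j\<le>p. \<integral>\<^sup>+ v. ennreal (\<alpha> j (q, v)) * indicator E (fst (S j (q, v))) \<partial>(V q))
        \<in> borel_measurable X"
    proof (rule borel_measurable_sum)
      fix j assume "j \<in> {..p}"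
      then have [measurable]: "S j \<in> X \<Otimes>\<^sub>M Y \<rightarrow>\<^sub>M X \<Otimes>\<^sub>M Y" "\<alpha> j \<in> borel_measurable (X \<Otimes>\<^sub>M Y)"
        using S \<alpha> by auto
      show "(\<lambda>q. \<integral>\<^sup>+ v. ennreal (\<alpha> j (q, v)) * indicator E (fst (S j (q, v))) \<partial>(V q))
          \<in> borel_measurable X"
        by (rule nn_integral_kernel_measurable[OF V]) measurable
    qed
    then show "(\<lambda>q. emeasure (involutive_kernel X p \<alpha> S V q) E) \<in> borel_measurable X"
      by (simp add: emeasure_involutive_kernel cong: measurable_cong)
  qed (auto simp: sets_involutive_kernel intro: prob prob_space_imp_subprob_space)
qed

text \<open>For fixed q the kernel is evaluated at the section of \<open>E\<close> over q. The
  finite sum is then moved outside, and the integrals over q and v recombine into one over the joint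
  law of \<mu> and \<open>V\<close>, with \<open>\<alpha> j\<close> as a density. In this form a
  change of variables by \<open>S j\<close> can act on each term.\<close>

lemma emeasure_kernel_joint_involutive_kernel:
  assumes mu: "prob_space \<mu>" "sets \<mu> = sets X"
    and sum: "\<And>q. q \<in> space X \<Longrightarrow> (\<Sum>j\<le>p. \<integral>\<^sup>+ v. ennreal (\<alpha> j (q, v)) \<partial>(V q)) = 1"
    and E: "E \<in> sets (X \<Otimes>\<^sub>M X)"
  shows "emeasure (kernel_joint X X \<mu> (involutive_kernel X p \<alpha> S V)) E
    = (\<Sum>j\<le>p. \<integral>\<^sup>+ z. indicator E (fst z, fst (S j z))
        \<partial>(density (kernel_joint X Y \<mu> V) (\<lambda>z. ennreal (\<alpha> j z))))"
proof -
  let ?P = "involutive_kernel X p \<alpha> S V"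
  note [measurable] = E
  note [measurable_cong] = sets_kernel_joint[OF mu V]
  have spmu: "space \<mu> = space X" using mu(2) by (rule sets_eq_imp_space_eq)
  have "emeasure (kernel_joint X X \<mu> ?P) E = (\<integral>\<^sup>+ q. \<integral>\<^sup>+ q'. indicator E (q, q') \<partial>(?P q) \<partial>\<mu>)"
    by (rule emeasure_kernel_joint[OF mu involutive_kernel_kernel[OF sum] E])
  also have "\<dots> = (\<integral>\<^sup>+ q. (\<Sum>j\<le>p. \<integral>\<^sup>+ v. ennreal (\<alpha> j (q, v)) * indicator E (q, fst (S j (q, v))) \<partial>(V q)) \<partial>\<mu>)"
  proof (rule nn_integral_cong)
    fix q assume "q \<in> space \<mu>"
    then have q: "q \<in> space X" using spmu by simp
    have Eq: "Pair q -` E \<in> sets X" by (rule sets_Pair1[OF E])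
    have "(\<integral>\<^sup>+ q'. indicator E (q, q') \<partial>(?P q)) = (\<integral>\<^sup>+ q'. indicator (Pair q -` E) q' \<partial>(?P q))"
      by (auto intro!: nn_integral_cong split: split_indicator)
    also have "\<dots> = emeasure (?P q) (Pair q -` E)"
      using Eq by (simp add: sets_involutive_kernel)
    also have "\<dots> = (\<Sum>j\<le>p. \<integral>\<^sup>+ v. ennreal (\<alpha> j (q, v)) * indicator E (q, fst (S j (q, v))) \<partial>(V q))"
      by (subst emeasure_involutive_kernel[OF q Eq])
        (auto intro!: sum.cong nn_integral_cong split: split_indicator)
    finally show "(\<integral>\<^sup>+ q'. indicator E (q, q') \<partial>(?P q))
      = (\<Sum>j\<le>p. \<integral>\<^sup>+ v. ennreal (\<alpha> j (q, v)) * indicator E (q, fst (S j (q, v))) \<partial>(V q))" .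
  qed
  also have "\<dots> = (\<Sum>j\<le>p. \<integral>\<^sup>+ q. \<integral>\<^sup>+ v. ennreal (\<alpha> j (q, v)) * indicator E (q, fst (S j (q, v))) \<partial>(V q) \<partial>\<mu>)"
  proof (rule nn_integral_sum)
    fix j assume "j \<in> {..p}"
    then have [measurable]: "S j \<in> X \<Otimes>\<^sub>M Y \<rightarrow>\<^sub>M X \<Otimes>\<^sub>M Y" "\<alpha> j \<in> borel_measurable (X \<Otimes>\<^sub>M Y)"
      using S \<alpha> by auto
    show "(\<lambda>q. \<integral>\<^sup>+ v. ennreal (\<alpha> j (q, v)) * indicator E (q, fst (S j (q, v))) \<partial>(V q))
        \<in> borel_measurable \<mu>"
      using nn_integral_kernel_measurable[OF V, of "\<lambda>z. ennreal (\<alpha> j z) * indicator E (fst z, fst (S j z))"]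
      by (simp add: measurable_cong_sets[OF mu(2) refl])
  qed
  also have "\<dots> = (\<Sum>j\<le>p. \<integral>\<^sup>+ z. indicator E (fst z, fst (S j z))
        \<partial>(density (kernel_joint X Y \<mu> V) (\<lambda>z. ennreal (\<alpha> j z))))"
  proof (rule sum.cong[OF refl])
    fix j assume "j \<in> {..p}"
    then have [measurable]: "S j \<in> X \<Otimes>\<^sub>M Y \<rightarrow>\<^sub>M X \<Otimes>\<^sub>M Y" "\<alpha> j \<in> borel_measurable (X \<Otimes>\<^sub>M Y)"
      using S \<alpha> by auto
    show "(\<integral>\<^sup>+ q. \<integral>\<^sup>+ v. ennreal (\<alpha> j (q, v)) * indicator E (q, fst (S j (q, v))) \<partial>(V q) \<partial>\<mu>)
      = (\<integral>\<^sup>+ z. indicator E (fst z, fst (S j z)) \<partial>(density (kernel_joint X Y \<mu> V) (\<lambda>z. ennreal (\<alpha> j z))))"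
      using nn_integral_kernel_joint[OF mu V, of "\<lambda>z. ennreal (\<alpha> j z) * indicator E (fst z, fst (S j z))"]
      by (simp add: nn_integral_density)
  qed
  finally show ?thesis .
qed

end

section \<open>From symmetry of the joint law to detailed balance and invariance\<close>

lemma measurable_prod_swap [measurable]:
  fixes A :: "'a measure" and B :: "'b measure"
  shows "prod.swap \<in> A \<Otimes>\<^sub>M B \<rightarrow>\<^sub>M B \<Otimes>\<^sub>M A"
proof -
  have swap: "prod.swap = (\<lambda>z :: 'a \<times> 'b. (snd z, fst z))" by auto
  show ?thesis unfolding swap by measurable
qed

lemma detailed_balanceI:
  assumes mu: "prob_space \<mu>" "sets \<mu> = sets X" and P: "P \<in> X \<rightarrow>\<^sub>M prob_algebra X"
    and eq: "\<And>E. E \<in> sets (X \<Otimes>\<^sub>M X) \<Longrightarrow> emeasure (kernel_joint X X \<mu> P) E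
      = emeasure (kernel_joint X X \<mu> P) (prod.swap -` E \<inter> space (X \<Otimes>\<^sub>M X))"
  shows "detailed_balance X \<mu> P"
proof -
  note s [measurable_cong] = sets_kernel_joint[OF mu P]
  show ?thesis unfolding detailed_balance_def
  proof (rule measure_eqI)
    fix E assume "E \<in> sets (kernel_joint X X \<mu> P)"
    then have E: "E \<in> sets (X \<Otimes>\<^sub>M X)" using s by simp
    then show "emeasure (kernel_joint X X \<mu> P) E
        = emeasure (distr (kernel_joint X X \<mu> P) (X \<Otimes>\<^sub>M X) prod.swap) E"
      by (subst emeasure_distr) (simp_all add: sets_eq_imp_space_eq[OF s] eq[OF E, symmetric])
  qed (simp add: s)
qed

text \<open>The second marginal of the joint law is \<open>bind \<mu> P\<close> and the first is
  \<mu>; symmetry under the exchange of coordinates makes them equal.\<close>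

lemma detailed_balance_imp_invariant:
  assumes mu: "prob_space \<mu>" "sets \<mu> = sets X" and P: "P \<in> X \<rightarrow>\<^sub>M prob_algebra X"
    and db: "detailed_balance X \<mu> P"
  shows "bind \<mu> P = \<mu>"
proof (rule measure_eqI)
  let ?J = "kernel_joint X X \<mu> P"
  note s [measurable_cong] = sets_kernel_joint[OF mu P]
  have P' [measurable]: "P \<in> \<mu> \<rightarrow>\<^sub>M subprob_algebra X"
    using measurable_prob_algebraD[OF P] by (simp add: measurable_cong_sets[OF mu(2) refl])
  have ne: "space \<mu> \<noteq> {}" using mu(1) by (rule prob_space.not_empty)
  show sb: "sets (bind \<mu> P) = sets \<mu>"
    using sets_bind[OF sets_kernel[OF P'] ne] mu(2) by simp
  have spmu: "space \<mu> = space X" using mu(2) by (rule sets_eq_imp_space_eq)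
  fix E assume "E \<in> sets (bind \<mu> P)"
  then have E [measurable]: "E \<in> sets X" using sb mu(2) by simp
  have Psets: "sets (P q) = sets X" if "q \<in> space X" for q
    using measurable_space[OF P that] by (simp add: space_prob_algebra)
  have "emeasure (bind \<mu> P) E = (\<integral>\<^sup>+ q. emeasure (P q) E \<partial>\<mu>)"
    by (rule emeasure_bind[OF ne P' E])
  also have "\<dots> = emeasure ?J (space X \<times> E)"
  proof -
    have "emeasure (P q) E = (\<integral>\<^sup>+ q'. indicator (space X \<times> E) (q, q') \<partial>(P q))"
      if "q \<in> space \<mu>" for q
      using that Psets spmu by (simp add: indicator_times)
    then show ?thesis
      by (subst emeasure_kernel_joint[OF mu P]) (auto intro: nn_integral_cong)
  qed
  also have "\<dots> = emeasure (distr ?J (X \<Otimes>\<^sub>M X) prod.swap) (space X \<times> E)"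
    using db by (simp add: detailed_balance_def)
  also have "\<dots> = emeasure ?J (E \<times> space X)"
  proof -
    have "prod.swap -` (space X \<times> E) \<inter> space ?J = E \<times> space X"
      using sets.sets_into_space[OF E] by (auto simp: sets_eq_imp_space_eq[OF s] space_pair_measure)
    then show ?thesis by (subst emeasure_distr) simp_all
  qed
  also have "\<dots> = emeasure \<mu> E"
    by (rule emeasure_kernel_joint_times_space[OF mu P E])
  finally show "emeasure (bind \<mu> P) E = emeasure \<mu> E" .
qed

section \<open>Balance for each involution, the marginal identity and reversibility of the
  kernel\<close>

theorem corollary2p4:
  fixes X :: "'a measure" and Y :: "'b measure"
    and \<mu> :: "'a measure" and V :: "'a \<Rightarrow> 'b measure"
    and M :: "('a \<times> 'b) measure"
    and p :: nat
    and S :: "nat \<Rightarrow> 'a \<times> 'b \<Rightarrow> 'a \<times> 'b"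
    and \<alpha> :: "nat \<Rightarrow> 'a \<times> 'b \<Rightarrow> real"
  assumes mu: "prob_space \<mu>" "sets \<mu> = sets X"
    and V: "V \<in> X \<rightarrow>\<^sub>M prob_algebra Y"
    and M: "M = kernel_joint X Y \<mu> V"
    and p: "p \<ge> 1"
    and S_meas: "\<And>j. j \<le> p \<Longrightarrow> S j \<in> X \<Otimes>\<^sub>M Y \<rightarrow>\<^sub>M X \<Otimes>\<^sub>M Y"
    and S_inv: "\<And>j z. j \<le> p \<Longrightarrow> z \<in> space (X \<Otimes>\<^sub>M Y) \<Longrightarrow> S j (S j z) = z"
    and S_sum: "\<And>j E. j \<le> p \<Longrightarrow> E \<in> sets (X \<Otimes>\<^sub>M Y) \<Longrightarrow>
      (\<Sum>k\<le>p. emeasure (distr M (X \<Otimes>\<^sub>M Y) (S j \<circ> S k)) E) =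
      (\<Sum>k\<le>p. emeasure (distr M (X \<Otimes>\<^sub>M Y) (S k)) E)"
    and alpha_meas: "\<And>j. j \<le> p \<Longrightarrow> \<alpha> j \<in> borel_measurable (X \<Otimes>\<^sub>M Y)"
    and alpha_range: "\<And>j z. j \<le> p \<Longrightarrow> z \<in> space (X \<Otimes>\<^sub>M Y) \<Longrightarrow> \<alpha> j z \<in> {0..1}"
    and alpha_sum: "\<And>q. q \<in> space X \<Longrightarrow> (\<Sum>j\<le>p. \<integral> v. \<alpha> j (q, v) \<partial>(V q)) = 1"
    and alpha_RN: "\<And>j. j \<le> p \<Longrightarrow>
      AE z in sum_measure (X \<Otimes>\<^sub>M Y) {..p} (\<lambda>k. distr M (X \<Otimes>\<^sub>M Y) (S k)).
        ennreal (\<alpha> j z) =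
          RN_deriv (sum_measure (X \<Otimes>\<^sub>M Y) {..p} (\<lambda>k. distr M (X \<Otimes>\<^sub>M Y) (S k)))
            (distr M (X \<Otimes>\<^sub>M Y) (S j)) z"
  shows "(\<forall>j\<le>p. density (distr M (X \<Otimes>\<^sub>M Y) (S j)) (\<lambda>z. ennreal (\<alpha> j (S j z)))
                 = density M (\<lambda>z. ennreal (\<alpha> j z)))
    \<and> sum_measure X {..p}
        (\<lambda>j. distr (density (distr M (X \<Otimes>\<^sub>M Y) (S j)) (\<lambda>z. ennreal (\<alpha> j (S j z)))) X fst) = \<mu>
    \<and> involutive_kernel X p \<alpha> S V \<in> X \<rightarrow>\<^sub>M prob_algebra X
    \<and> detailed_balance X \<mu> (involutive_kernel X p \<alpha> S V)
    \<and> bind \<mu> (involutive_kernel X p \<alpha> S V) = \<mu>"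
proof -
  let ?Z = "X \<Otimes>\<^sub>M Y"
  let ?N = "\<lambda>j. distr M ?Z (S j)"
  let ?R = "sum_measure ?Z {..p} ?N"
  let ?P = "involutive_kernel X p \<alpha> S V"
  have sM [measurable_cong]: "sets M = sets ?Z" unfolding M by (rule sets_kernel_joint[OF mu V])
  have spM: "space M = space ?Z" using sM by (rule sets_eq_imp_space_eq)
  have spmu: "space \<mu> = space X" using mu(2) by (rule sets_eq_imp_space_eq)
  interpret M: prob_space M unfolding M by (rule prob_space_kernel_joint[OF mu V])
  have S_M: "S j \<in> M \<rightarrow>\<^sub>M ?Z" if "j \<le> p" for j
    using S_meas[OF that] by (simp add: measurable_cong_sets[OF sM refl])
  have R: "emeasure ?R E = (\<Sum>k\<le>p. emeasure (?N k) E)" if "E \<in> sets ?Z" for E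
    using that by (intro emeasure_sum_measure) auto
  have N_finite: "emeasure (?N k) E \<noteq> \<infinity>" if "k \<le> p" for k E
    using finite_measure.emeasure_finite[OF M.finite_measure_distr[OF S_M[OF that]]] by simp
  \<comment> \<open>A finite sum of finite measures is finite, which makes the Radon-Nikodym theorem
    available over \<open>?R\<close>.\<close>
  interpret R: finite_measure ?R
    using N_finite by (intro finite_measureI) (simp add: R)
  have N_density: "density ?R (\<lambda>z. ennreal (\<alpha> j z)) = ?N j" if j: "j \<le> p" for j
  proof -
    \<comment> \<open>On a null set of \<open>?R\<close> a finite sum of nonnegative terms vanishes,
      and the measure under \<open>?N j\<close> is one of these terms.\<close>
    have ac: "absolutely_continuous ?R (?N j)"
      unfolding absolutely_continuous_def null_sets_def using j by (auto simp: R)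
    have "density ?R (\<lambda>z. ennreal (\<alpha> j z)) = density ?R (RN_deriv ?R (?N j))"
      using alpha_RN[OF j] alpha_meas[OF j] by (intro density_cong) auto
    also have "\<dots> = ?N j"
      using ac by (intro R.density_RN_deriv) simp_all
    finally show ?thesis .
  qed
  \<comment> \<open>Pushing \<open>?R\<close> forward by \<open>S j\<close> pushes each summand
    forward, giving the images under \<open>S j \<circ> S k\<close>; hypothesis \<open>S_sum\<close>
    says that their sum is again \<open>?R\<close>.\<close>
  have R_inv: "distr ?R ?Z (S j) = ?R" if j: "j \<le> p" for j
  proof (rule measure_eqI)
    fix E assume "E \<in> sets (distr ?R ?Z (S j))"
    then have E: "E \<in> sets ?Z" by simp
    have E': "S j -` E \<inter> space ?Z \<in> sets ?Z" using S_meas[OF j] E by (rule measurable_sets)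
    have "emeasure (distr ?R ?Z (S j)) E = emeasure ?R (S j -` E \<inter> space ?Z)"
      using E S_meas[OF j] by (simp add: emeasure_distr measurable_cong_sets[OF sets_sum_measure refl])
    also have "\<dots> = (\<Sum>k\<le>p. emeasure (distr M ?Z (S j \<circ> S k)) E)"
    proof (subst R[OF E'], rule sum.cong[OF refl])
      fix k assume "k \<in> {..p}"
      then have k: "k \<le> p" by simp
      have "distr M ?Z (S j \<circ> S k) = distr (?N k) ?Z (S j)"
        by (rule distr_distr[symmetric, OF S_meas[OF j] S_M[OF k]])
      then show "emeasure (?N k) (S j -` E \<inter> space ?Z) = emeasure (distr M ?Z (S j \<circ> S k)) E"
        using E S_meas[OF j] by (simp add: emeasure_distr)
    qed
    also have "\<dots> = emeasure ?R E" using S_sum[OF j E] R[OF E] by simp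
    finally show "emeasure (distr ?R ?Z (S j)) E = emeasure ?R E" .
  qed simp
  have balance: "density (?N j) (\<lambda>z. ennreal (\<alpha> j (S j z))) = density M (\<lambda>z. ennreal (\<alpha> j z))"
    if j: "j \<le> p" for j
    using alpha_meas[OF j]
    by (intro density_involution_symmetric[OF sM S_meas[OF j] S_inv[OF j] sets_sum_measure R_inv[OF j] _ N_density[OF j]])
      simp_all
  have alpha_M_inv: "distr (density M (\<lambda>z. ennreal (\<alpha> j z))) ?Z (S j) = density M (\<lambda>z. ennreal (\<alpha> j z))"
    if j: "j \<le> p" for j
    using distr_density_involution[OF sM S_meas[OF j] S_inv[OF j], of "\<lambda>z. ennreal (\<alpha> j z)"]
      balance[OF j] alpha_meas[OF j] by simp
  \<comment> \<open>The normalization is given for Bochner integrals, which are 0 by convention when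
    the integrand is not integrable. Values in [0,1] on a probability space ensure integrability, so
    both integrals agree.\<close>
  have sum: "(\<Sum>j\<le>p. \<integral>\<^sup>+ v. ennreal (\<alpha> j (q, v)) \<partial>(V q)) = 1" if q: "q \<in> space X" for q
  proof -
    have Vq: "prob_space (V q)" "sets (V q) = sets Y"
      using measurable_space[OF V q] by (auto simp: space_prob_algebra)
    interpret Vq: prob_space "V q" by fact
    have spV: "space (V q) = space Y" using Vq(2) by (rule sets_eq_imp_space_eq)
    have Pair: "Pair q \<in> V q \<rightarrow>\<^sub>M ?Z"
      using q by (simp add: measurable_cong_sets[OF Vq(2) refl])
    have rng: "0 \<le> \<alpha> j (q, v)" "\<alpha> j (q, v) \<le> 1" if "j \<le> p" "v \<in> space (V q)" for j v
      using alpha_range[OF that(1), of "(q, v)"] that(2) q spV by (auto simp: space_pair_measure)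
    have "(\<integral>\<^sup>+ v. ennreal (\<alpha> j (q, v)) \<partial>(V q)) = ennreal (\<integral> v. \<alpha> j (q, v) \<partial>(V q))"
      if j: "j \<le> p" for j
    proof (rule nn_integral_eq_integral)
      show "integrable (V q) (\<lambda>v. \<alpha> j (q, v))"
        using measurable_compose[OF Pair alpha_meas[OF j]] rng[OF j]
        by (intro Vq.integrable_const_bound[where B = 1]) auto
    qed (use rng[OF j] in auto)
    then have "(\<Sum>j\<le>p. \<integral>\<^sup>+ v. ennreal (\<alpha> j (q, v)) \<partial>(V q)) = (\<Sum>j\<le>p. ennreal (\<integral> v. \<alpha> j (q, v) \<partial>(V q)))"
      by simp
    also have "\<dots> = ennreal (\<Sum>j\<le>p. \<integral> v. \<alpha> j (q, v) \<partial>(V q))"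
      using rng by (intro sum_ennreal integral_nonneg_AE) auto
    finally show ?thesis using alpha_sum[OF q] by simp
  qed
  have P: "?P \<in> X \<rightarrow>\<^sub>M prob_algebra X"
    by (rule involutive_kernel_kernel[OF V S_meas alpha_meas sum])
  have joint: "emeasure (kernel_joint X X \<mu> ?P) E
      = (\<Sum>j\<le>p. \<integral>\<^sup>+ z. indicator E (fst z, fst (S j z)) \<partial>(density M (\<lambda>z. ennreal (\<alpha> j z))))"
    if "E \<in> sets (X \<Otimes>\<^sub>M X)" for E
    unfolding M by (rule emeasure_kernel_joint_involutive_kernel[OF V S_meas alpha_meas mu sum that])
  have db: "detailed_balance X \<mu> ?P"
  proof (rule detailed_balanceI[OF mu P])
    fix E assume E [measurable]: "E \<in> sets (X \<Otimes>\<^sub>M X)"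
    have E': "prod.swap -` E \<inter> space (X \<Otimes>\<^sub>M X) \<in> sets (X \<Otimes>\<^sub>M X)" by measurable
    show "emeasure (kernel_joint X X \<mu> ?P) E
        = emeasure (kernel_joint X X \<mu> ?P) (prod.swap -` E \<inter> space (X \<Otimes>\<^sub>M X))"
    proof (subst joint[OF E], subst joint[OF E'], rule sum.cong[OF refl])
      fix j assume "j \<in> {..p}"
      then have j: "j \<le> p" by simp
      note [measurable] = S_meas[OF j]
      let ?D = "density M (\<lambda>z. ennreal (\<alpha> j z))"
      \<comment> \<open>Replacing \<open>?D\<close> by its own image under \<open>S j\<close>
        substitutes \<open>S j z\<close> for z. As \<open>S j (S j z) = z\<close>, the two
        coordinates trade places, and this is membership in the swapped set.\<close>
      have "(\<integral>\<^sup>+ z. indicator E (fst z, fst (S j z)) \<partial>?D)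
          = (\<integral>\<^sup>+ z. indicator E (fst z, fst (S j z)) \<partial>(distr ?D ?Z (S j)))"
        by (simp add: alpha_M_inv[OF j])
      also have "\<dots> = (\<integral>\<^sup>+ z. indicator E (fst (S j z), fst (S j (S j z))) \<partial>?D)"
        by (rule nn_integral_distr) measurable
      also have "\<dots> = (\<integral>\<^sup>+ z. indicator (prod.swap -` E \<inter> space (X \<Otimes>\<^sub>M X)) (fst z, fst (S j z)) \<partial>?D)"
      proof (rule nn_integral_cong)
        fix z assume "z \<in> space ?D"
        then have z: "z \<in> space ?Z" using spM by simp
        show "indicator E (fst (S j z), fst (S j (S j z)))
            = (indicator (prod.swap -` E \<inter> space (X \<Otimes>\<^sub>M X)) (fst z, fst (S j z)) :: ennreal)"
          using z measurable_space[OF S_meas[OF j] z] S_inv[OF j z]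
          by (auto simp: space_pair_measure indicator_def)
      qed
      finally show "(\<integral>\<^sup>+ z. indicator E (fst z, fst (S j z)) \<partial>?D)
        = (\<integral>\<^sup>+ z. indicator (prod.swap -` E \<inter> space (X \<Otimes>\<^sub>M X)) (fst z, fst (S j z)) \<partial>?D)" .
    qed
  qed
  \<comment> \<open>By \<open>balance\<close> the summands are the first marginals of the measures
    \<open>\<alpha>\<^sub>j M\<close>. The condition that \<open>fst (S j z)\<close> lies in
    \<open>space X\<close> always holds; inserting it turns the sum into the joint law at
    \<open>E \<times> space X\<close>, whose value is the first marginal \<mu>.\<close>
  have marginal: "sum_measure X {..p}
      (\<lambda>j. distr (density (?N j) (\<lambda>z. ennreal (\<alpha> j (S j z)))) X fst) = \<mu>" (is "?L = _")
  proof (rule measure_eqI)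
    fix E assume "E \<in> sets ?L"
    then have E [measurable]: "E \<in> sets X" by simp
    have "emeasure ?L E = (\<Sum>j\<le>p. emeasure (distr (density M (\<lambda>z. ennreal (\<alpha> j z))) X fst) E)"
      by (subst emeasure_sum_measure) (auto simp: balance)
    also have "\<dots> = (\<Sum>j\<le>p. \<integral>\<^sup>+ z. indicator (E \<times> space X) (fst z, fst (S j z)) \<partial>(density M (\<lambda>z. ennreal (\<alpha> j z))))"
    proof (rule sum.cong[OF refl])
      fix j assume "j \<in> {..p}"
      then have j: "j \<le> p" by simp
      let ?D = "density M (\<lambda>z. ennreal (\<alpha> j z))"
      have "emeasure (distr ?D X fst) E = (\<integral>\<^sup>+ z. indicator E z \<partial>(distr ?D X fst))" by simp
      also have "\<dots> = (\<integral>\<^sup>+ z. indicator E (fst z) \<partial>?D)"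
        by (rule nn_integral_distr) measurable
      also have "\<dots> = (\<integral>\<^sup>+ z. indicator (E \<times> space X) (fst z, fst (S j z)) \<partial>?D)"
      proof (rule nn_integral_cong)
        fix z assume "z \<in> space ?D"
        then have "S j z \<in> space ?Z"
          using measurable_space[OF S_meas[OF j]] spM by simp
        then have "fst (S j z) \<in> space X" by (auto simp: space_pair_measure)
        then show "indicator E (fst z) = (indicator (E \<times> space X) (fst z, fst (S j z)) :: ennreal)"
          by (simp add: indicator_times)
      qed
      finally show "emeasure (distr ?D X fst) E
        = (\<integral>\<^sup>+ z. indicator (E \<times> space X) (fst z, fst (S j z)) \<partial>?D)" .
    qed
    also have "\<dots> = emeasure (kernel_joint X X \<mu> ?P) (E \<times> space X)"
      by (rule joint[symmetric]) simp
    also have "\<dots> = emeasure \<mu> E"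
      by (rule emeasure_kernel_joint_times_space[OF mu P E])
    finally show "emeasure ?L E = emeasure \<mu> E" .
  qed (simp add: mu(2))
  show ?thesis
    using balance marginal P db detailed_balance_imp_invariant[OF mu P db] by blast
qed

end
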